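(* Let $n\geq 1$, let $p(z)$ be any monic polynomial of degree $n$, and let $\mathcal{M}_n$ be the family of all $n\times n$ matrices with entries in $\{-1,+1\}$. Then $$L_n = 2^{-n^2}\sum_{X\in\mathcal{M}_n} p(\mathrm{Per}\,X)\,\pi(X),$$ where $\mathrm{Per}\,X$ is the permanent of $X$ and $\pi(X)$ is the product of all the entries of $X$.
   Context: A Latin square of order $n$ is an $n\times n$ array with entries from $\{1,\dots,n\}$ in which each row and each column contains each symbol exactly once. $L_n$ denotes the total number of Latin squares of order $n$. *)

theory Defs
  imports Complex_Main "Jordan_Normal_Form.Matrix" "HOL-Combinatorics.Permutations"
    "HOL-Computational_Algebra.Polynomial"
begin

text \<open>Rows and columns are indexed from 0, as usual for \<^typ>\<open>'a mat\<close>; symbols are \<open>1, \<dots>, n\<close>.\<close>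

definition latin_square :: "nat \<Rightarrow> nat mat \<Rightarrow> bool" where
  "latin_square n A \<longleftrightarrow>
     A \<in> carrier_mat n n \<and>
     elements_mat A \<subseteq> {1..n} \<and>
     (\<forall>i<n. \<forall>k\<in>{1..n}. \<exists>!j. j < n \<and> A $$ (i, j) = k) \<and>
     (\<forall>j<n. \<forall>k\<in>{1..n}. \<exists>!i. i < n \<and> A $$ (i, j) = k)"

definition num_latin_squares :: "nat \<Rightarrow> nat" where
  "num_latin_squares n = card {A. latin_square n A}"

text \<open>Like the library's determinant, the permanent of a non-square matrix is set to 0.\<close>

definition permanent :: "'a::comm_ring_1 mat \<Rightarrow> 'a" where
  "permanent A = (if dim_row A = dim_col A then
     (\<Sum>\<sigma> | \<sigma> permutes {0..<dim_row A}. \<Prod>i = 0..<dim_row A. A $$ (i, \<sigma> i)) else 0)"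

definition prod_entries :: "'a::comm_ring_1 mat \<Rightarrow> 'a" where
  "prod_entries A = (\<Prod>i = 0..<dim_row A. \<Prod>j = 0..<dim_col A. A $$ (i, j))"

definition sign_matrices :: "nat \<Rightarrow> complex mat set" where
  "sign_matrices n = {X \<in> carrier_mat n n. elements_mat X \<subseteq> {-1, 1}}"

lemma finite_mats_with_entries:
  assumes "finite S"
  shows "finite {A \<in> carrier_mat m n. elements_mat A \<subseteq> S}"
proof (rule finite_subset)
  let ?I = "{0..<m} \<times> {0..<n}"
  show "{A \<in> carrier_mat m n. elements_mat A \<subseteq> S} \<subseteq> mat m n ` (?I \<rightarrow>\<^sub>E S)"
  proof
    fix A assume A: "A \<in> {A \<in> carrier_mat m n. elements_mat A \<subseteq> S}"
    then have "A = mat m n (restrict (\<lambda>ij. A $$ ij) ?I)" by (intro eq_matI) auto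
    moreover have "restrict (\<lambda>ij. A $$ ij) ?I \<in> ?I \<rightarrow>\<^sub>E S"
    proof (rule restrict_PiE_iff[THEN iffD2], rule ballI)
      fix ij assume "ij \<in> ?I"
      then have "A $$ ij \<in> elements_mat A"
        using A elements_matI[of A m n "fst ij" "snd ij" "A $$ ij"] by auto
      then show "A $$ ij \<in> S" using A by blast
    qed
    ultimately show "A \<in> mat m n ` (?I \<rightarrow>\<^sub>E S)" by blast
  qed
  show "finite (mat m n ` (?I \<rightarrow>\<^sub>E S))" using assms by (intro finite_imageI finite_PiE) auto
qed

lemma finite_latin_squares: "finite {A. latin_square n A}"
  by (rule finite_subset[OF _ finite_mats_with_entries[of "{1..n}" n n]])
    (auto simp: latin_square_def)

lemma finite_sign_matrices: "finite (sign_matrices n)"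
  unfolding sign_matrices_def by (rule finite_mats_with_entries) simp

end

theory Submission
  imports Defs
begin

text \<open>
  Expand a power \<open>(Per X)\<^sup>k\<close> into a sum over sequences of \<open>k\<close> permutations. Multiplying by
  \<open>\<pi>(X)\<close> and summing over all sign matrices, the contribution of a sequence factors over the cells
  \<open>(i, j)\<close>: it is \<open>2 ^ n\<^sup>2\<close> if every cell is hit by an odd number of the permutations, and 0
  otherwise. As the \<open>k\<close> permutations hit \<open>k\<close> cells of each row, no sequence contributes if \<open>k < n\<close>,
  and for \<open>k = n\<close> the contributing sequences hit every cell exactly once. The latter are
  the Latin squares, the \<open>t\<close>-th permutation marking the cells with the \<open>t\<close>-th symbol; so only the
  leading term of the polynomial matters.
\<close>

section \<open>Power sums of the permanent over sign matrices\<close>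

text \<open>Sequences are extensional functions, \<open>undefined\<close> from index
  \<open>k\<close> on, so each list of \<open>k\<close> permutations is represented exactly once and
  cardinalities count lists. The cell \<open>(i, j)\<close> is hit by the \<open>t\<close>-th
  permutation when \<open>S t i = j\<close>.\<close>

definition odd_cover_seqs :: "nat \<Rightarrow> nat \<Rightarrow> (nat \<Rightarrow> nat \<Rightarrow> nat) set" where
  "odd_cover_seqs n k = {S \<in> {0..<k} \<rightarrow>\<^sub>E {\<sigma>. \<sigma> permutes {0..<n}}.
     \<forall>i<n. \<forall>j<n. odd (card {t\<in>{0..<k}. S t i = j})}"

text \<open>Grouping the factors by the value of \<open>g\<close> turns a product along a sequence
  into a monomial whose exponents are the hit counts.\<close>

lemma prod_comp_eq_prod_power_card:
  fixes f :: "'b \<Rightarrow> 'c::comm_monoid_mult"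
  assumes "finite T" "finite J" "g ` T \<subseteq> J"
  shows "(\<Prod>t\<in>T. f (g t)) = (\<Prod>j\<in>J. f j ^ card {t\<in>T. g t = j})"
proof -
  have "(\<Prod>t\<in>T. f (g t)) = (\<Prod>j\<in>J. \<Prod>t\<in>{t\<in>T. g t = j}. f (g t))"
    using prod.group[OF assms, of "\<lambda>t. f (g t)"] by simp
  also have "\<dots> = (\<Prod>j\<in>J. f j ^ card {t\<in>T. g t = j})"
    by (intro prod.cong refl) simp
  finally show ?thesis .
qed

text \<open>This lets a sum over sign matrices run over independent choices of sign in each cell,
  the form that \<open>prod_sum_PiE\<close> needs. Injectivity rests on extensionality, since
  \<open>mat n n\<close> ignores values off the index set.\<close>

lemma bij_betw_mat_sign_matrices:
  "bij_betw (mat n n) ({0..<n} \<times> {0..<n} \<rightarrow>\<^sub>E {-1, 1}) (sign_matrices n)"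
proof (rule bij_betw_imageI)
  let ?I = "{0..<n} \<times> {0..<n}"
  show "inj_on (mat n n) (?I \<rightarrow>\<^sub>E {-1, 1 :: complex})"
  proof (rule inj_onI, rule PiE_ext, assumption, assumption)
    fix f g :: "nat \<times> nat \<Rightarrow> complex" and x
    assume eq: "mat n n f = mat n n g" and x: "x \<in> ?I"
    have "mat n n f $$ x = mat n n g $$ x" by (simp add: eq)
    then show "f x = g x" using x by auto
  qed
  show "mat n n ` (?I \<rightarrow>\<^sub>E {-1, 1}) = sign_matrices n"
  proof (intro equalityI subsetI)
    fix A assume "A \<in> mat n n ` (?I \<rightarrow>\<^sub>E {-1, 1 :: complex})"
    then obtain f where f: "f \<in> ?I \<rightarrow>\<^sub>E {-1, 1}" and A: "A = mat n n f" by blast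
    have "f (i, j) \<in> {-1, 1}" if "i < n" "j < n" for i j
      using PiE_mem[OF f, of "(i, j)"] that by simp
    then show "A \<in> sign_matrices n"
      unfolding sign_matrices_def A by (fastforce simp: elements_mat_def)
  next
    fix A assume A: "A \<in> sign_matrices n"
    then have "A = mat n n (restrict (\<lambda>ij. A $$ ij) ?I)"
      by (intro eq_matI) (auto simp: sign_matrices_def)
    moreover have "A $$ ij \<in> {-1, 1}" if "ij \<in> ?I" for ij
      using A that elements_matI[of A n n "fst ij" "snd ij" "A $$ ij"]
      by (auto simp: sign_matrices_def)
    then have "restrict (\<lambda>ij. A $$ ij) ?I \<in> ?I \<rightarrow>\<^sub>E {-1, 1}"
      by (intro restrict_PiE_iff[THEN iffD2]) blast
    ultimately show "A \<in> mat n n ` (?I \<rightarrow>\<^sub>E {-1, 1})" by blast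
  qed
qed

text \<open>Distributing the \<open>k\<close> equal factors picks one permutation from each, and
  collecting equal entries row by row leaves a monomial in the cells. The exponent of a cell is the
  number of times the sequence hits it.\<close>

lemma permanent_power_mat:
  fixes f :: "nat \<times> nat \<Rightarrow> 'a::comm_ring_1"
  shows "permanent (mat n n f) ^ k =
    (\<Sum>S\<in>{0..<k} \<rightarrow>\<^sub>E {\<sigma>. \<sigma> permutes {0..<n}}.
      \<Prod>ij\<in>{0..<n} \<times> {0..<n}. f ij ^ card {t\<in>{0..<k}. S t (fst ij) = snd ij})"
proof -
  let ?P = "{\<sigma>. \<sigma> permutes {0..<n}}"
  have "permanent (mat n n f) = (\<Sum>\<sigma>\<in>?P. \<Prod>i = 0..<n. f (i, \<sigma> i))"
  proof -
    have "mat n n f $$ (i, \<sigma> i) = f (i, \<sigma> i)" if "\<sigma> \<in> ?P" "i \<in> {0..<n}" for \<sigma> i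
      using that permutes_in_image[of \<sigma> "{0..<n}" i] by simp
    then show ?thesis
      unfolding permanent_def dim_row_mat dim_col_mat by (auto intro!: sum.cong prod.cong)
  qed
  then have "permanent (mat n n f) ^ k = (\<Prod>t = 0..<k. \<Sum>\<sigma>\<in>?P. \<Prod>i = 0..<n. f (i, \<sigma> i))"
    by simp
  also have "\<dots> = (\<Sum>S\<in>{0..<k} \<rightarrow>\<^sub>E ?P. \<Prod>t = 0..<k. \<Prod>i = 0..<n. f (i, S t i))"
    by (rule prod_sum_PiE) (auto simp: finite_permutations)
  also have "\<dots> = (\<Sum>S\<in>{0..<k} \<rightarrow>\<^sub>E ?P.
      \<Prod>ij\<in>{0..<n} \<times> {0..<n}. f ij ^ card {t\<in>{0..<k}. S t (fst ij) = snd ij})"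
  proof (rule sum.cong[OF refl])
    fix S assume S: "S \<in> {0..<k} \<rightarrow>\<^sub>E ?P"
    have "(\<Prod>t = 0..<k. \<Prod>i = 0..<n. f (i, S t i)) = (\<Prod>i = 0..<n. \<Prod>t = 0..<k. f (i, S t i))"
      by (rule prod.swap)
    also have "\<dots> = (\<Prod>i = 0..<n. \<Prod>j = 0..<n. f (i, j) ^ card {t\<in>{0..<k}. S t i = j})"
    proof (rule prod.cong[OF refl])
      fix i assume i: "i \<in> {0..<n}"
      have "S t i \<in> {0..<n}" if "t \<in> {0..<k}" for t
        using PiE_mem[OF S that] i permutes_in_image[of "S t" "{0..<n}" i] by simp
      then show "(\<Prod>t = 0..<k. f (i, S t i)) = (\<Prod>j = 0..<n. f (i, j) ^ card {t\<in>{0..<k}. S t i = j})"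
        by (intro prod_comp_eq_prod_power_card[where f = "\<lambda>j. f (i, j)"]) auto
    qed
    also have "\<dots> = (\<Prod>ij\<in>{0..<n} \<times> {0..<n}. f ij ^ card {t\<in>{0..<k}. S t (fst ij) = snd ij})"
      by (simp add: prod.cartesian_product case_prod_beta)
    finally show "(\<Prod>t = 0..<k. \<Prod>i = 0..<n. f (i, S t i)) = \<dots>" .
  qed
  finally show ?thesis .
qed

lemma sum_sign_matrices_permanent_power:
  "(\<Sum>X\<in>sign_matrices n. permanent X ^ k * prod_entries X) =
    2 ^ (n ^ 2) * of_nat (card (odd_cover_seqs n k))"
proof -
  let ?I = "{0..<n} \<times> {0..<n}" and ?Q = "{0..<k} \<rightarrow>\<^sub>E {\<sigma>. \<sigma> permutes {0..<n}}"
  let ?c = "\<lambda>S ij. card {t\<in>{0..<k}. S t (fst ij) = snd ij}"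
  have fin: "finite ?Q" by (intro finite_PiE) (auto simp: finite_permutations)
  have pe: "prod_entries (mat n n f) = (\<Prod>ij\<in>?I. f ij)" for f :: "nat \<times> nat \<Rightarrow> complex"
    by (simp add: prod_entries_def prod.cartesian_product case_prod_beta)
  have "(\<Sum>X\<in>sign_matrices n. permanent X ^ k * prod_entries X) =
      (\<Sum>f\<in>?I \<rightarrow>\<^sub>E {-1, 1}. permanent (mat n n f) ^ k * prod_entries (mat n n f))"
    by (rule sum.reindex_bij_betw[OF bij_betw_mat_sign_matrices, symmetric])
  \<comment> \<open>\<open>prod_entries\<close> contributes every cell once more, hence the
    \<open>Suc\<close> in the exponent.\<close>
  also have "\<dots> = (\<Sum>f\<in>?I \<rightarrow>\<^sub>E {-1, 1}. \<Sum>S\<in>?Q. \<Prod>ij\<in>?I. f ij ^ Suc (?c S ij))"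
    unfolding permanent_power_mat pe sum_distrib_right prod.distrib[symmetric]
    by (simp add: mult.commute)
  also have "\<dots> = (\<Sum>S\<in>?Q. \<Sum>f\<in>?I \<rightarrow>\<^sub>E {-1, 1}. \<Prod>ij\<in>?I. f ij ^ Suc (?c S ij))"
    by (rule sum.swap)
  \<comment> \<open>The signs in different cells are chosen independently, so the sum of products is
    a product of sums over single signs.\<close>
  also have "\<dots> = (\<Sum>S\<in>?Q. \<Prod>ij\<in>?I. \<Sum>x\<in>{-1, 1}. x ^ Suc (?c S ij))"
    by (intro sum.cong refl prod_sum_PiE[symmetric]) auto
  also have "\<dots> = (\<Sum>S\<in>?Q. if S \<in> odd_cover_seqs n k then 2 ^ (n ^ 2) else 0)"
  proof (rule sum.cong[OF refl])
    fix S assume S: "S \<in> ?Q"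
    \<comment> \<open>The factor of a cell hit \<open>m\<close> times is
      \<open>(-1) ^ (m + 1) + 1\<close>, so a single evenly hit cell annihilates the whole
      product.\<close>
    have two: "(\<Sum>x\<in>{-1, 1 :: complex}. x ^ Suc m) = (if odd m then 2 else 0)" for m
      by auto
    have mem: "S \<in> odd_cover_seqs n k \<longleftrightarrow> (\<forall>ij\<in>?I. odd (?c S ij))"
      using S by (auto simp: odd_cover_seqs_def)
    show "(\<Prod>ij\<in>?I. \<Sum>x\<in>{-1, 1 :: complex}. x ^ Suc (?c S ij)) =
        (if S \<in> odd_cover_seqs n k then 2 ^ (n ^ 2) else 0)"
    proof (cases "S \<in> odd_cover_seqs n k")
      case True
      then have "(\<Prod>ij\<in>?I. if odd (?c S ij) then 2 else 0 :: complex) = (\<Prod>ij\<in>?I. 2)"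
        unfolding mem by (intro prod.cong) auto
      then show ?thesis
        unfolding two using True by (simp add: power2_eq_square)
    next
      case False
      then obtain ij where "ij \<in> ?I" "even (?c S ij)" unfolding mem by blast
      then have "(\<Prod>ij\<in>?I. if odd (?c S ij) then 2 else 0 :: complex) = 0"
        by (intro prod_zero bexI[of _ ij]) auto
      then show ?thesis unfolding two using False by simp
    qed
  qed
  also have "\<dots> = 2 ^ (n ^ 2) * of_nat (card (odd_cover_seqs n k))"
  proof -
    have "?Q \<inter> {S. S \<in> odd_cover_seqs n k} = odd_cover_seqs n k"
      by (auto simp: odd_cover_seqs_def)
    then show ?thesis using fin by (simp add: sum.If_cases)
  qed
  finally show ?thesis .
qed

section \<open>Counting hits within one row\<close>

lemma permutes_seq_less:
  fixes S :: "nat \<Rightarrow> nat \<Rightarrow> nat"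
  assumes "S \<in> {0..<k} \<rightarrow>\<^sub>E {\<sigma>. \<sigma> permutes {0..<n}}" "t < k" "i < n"
  shows "S t i < n"
  using PiE_mem[OF assms(1), of t] assms(2,3) permutes_in_image[of "S t" "{0..<n}" i] by simp

text \<open>Each of the \<open>k\<close> permutations hits exactly one cell of row \<open>i\<close>,
  so the hit counts of that row partition the \<open>k\<close> indices.\<close>

lemma sum_card_hits:
  fixes S :: "nat \<Rightarrow> nat \<Rightarrow> nat"
  assumes S: "S \<in> {0..<k} \<rightarrow>\<^sub>E {\<sigma>. \<sigma> permutes {0..<n}}" and "i < n"
  shows "(\<Sum>j = 0..<n. card {t\<in>{0..<k}. S t i = j}) = k"
  using sum.group[of "{0..<k}" "{0..<n}" "\<lambda>t. S t i" "\<lambda>_. 1 :: nat"]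
    permutes_seq_less[OF S _ \<open>i < n\<close>] by (auto simp: image_subset_iff)

lemma odd_cover_seqs_card_ge_one:
  assumes "S \<in> odd_cover_seqs n k" "i < n" "j < n"
  shows "1 \<le> card {t\<in>{0..<k}. S t i = j}"
  using assms odd_pos[of "card {t\<in>{0..<k}. S t i = j}"]
  by (auto simp: odd_cover_seqs_def Suc_le_eq)

lemma odd_cover_seqs_empty:
  assumes "k < n"
  shows "odd_cover_seqs n k = {}"
proof (rule equals0I)
  fix S assume S: "S \<in> odd_cover_seqs n k"
  have "n = (\<Sum>j = 0..<n. 1)" by simp
  \<comment> \<open>Row 0 exists because \<open>k < n\<close> forces \<open>n\<close> to be
    positive; any row would do.\<close>
  also have "\<dots> \<le> (\<Sum>j = 0..<n. card {t\<in>{0..<k}. S t 0 = j})"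
    using assms odd_cover_seqs_card_ge_one[OF S] by (intro sum_mono) auto
  also have "\<dots> = k"
    using S assms by (intro sum_card_hits) (auto simp: odd_cover_seqs_def)
  finally show False using assms by simp
qed

text \<open>With \<open>k = n\<close>, a row receives \<open>n\<close> hits on \<open>n\<close>
  cells, each hit at least once, so no cell can be hit twice. Conversely, 1 is odd.\<close>

lemma odd_cover_seqs_diag:
  "odd_cover_seqs n n = {S \<in> {0..<n} \<rightarrow>\<^sub>E {\<sigma>. \<sigma> permutes {0..<n}}.
     \<forall>i<n. \<forall>j<n. \<exists>!t. t < n \<and> S t i = j}"
proof -
  have one: "(\<exists>!t. t < n \<and> S t i = j) \<longleftrightarrow> card {t\<in>{0..<n}. S t i = j} = 1"
    for S :: "nat \<Rightarrow> nat \<Rightarrow> nat" and i j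
  proof -
    have "(\<exists>!t. t < n \<and> S t i = j) \<longleftrightarrow> is_singleton {t\<in>{0..<n}. S t i = j}"
      unfolding is_singleton_def set_eq_iff Ex1_def by simp metis
    then show ?thesis by (simp add: is_singleton_altdef)
  qed
  have "card {t\<in>{0..<n}. S t i = j} = 1"
    if S: "S \<in> odd_cover_seqs n n" and i: "i < n" and j: "j < n" for S i j
  proof (rule ccontr)
    assume "card {t\<in>{0..<n}. S t i = j} \<noteq> 1"
    \<comment> \<open>All counts are at least 1, so a count different from 1 makes the row total
      strictly exceed \<open>n\<close>.\<close>
    then have "(\<Sum>j = 0..<n. 1) < (\<Sum>j = 0..<n. card {t\<in>{0..<n}. S t i = j})"
      using odd_cover_seqs_card_ge_one[OF S i] j
      by (intro sum_strict_mono_ex1) (auto intro!: bexI[of _ j] simp: le_neq_implies_less)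
    also have "\<dots> = n"
      using S i by (intro sum_card_hits) (auto simp: odd_cover_seqs_def)
    finally show False by simp
  qed
  then show ?thesis
    unfolding one by (auto simp: odd_cover_seqs_def)
qed

section \<open>Bijection with Latin squares\<close>

text \<open>\<open>sq\<close> writes the index of the only permutation that hits a cell into that
  cell. Its inverse reads off, for each symbol, the permutation taking a row to the column where the
  symbol stands.\<close>

lemma card_odd_cover_seqs_diag: "card (odd_cover_seqs n n) = num_latin_squares n"
proof -
  \<comment> \<open>Permutations are indexed from 0 and symbols from 1, hence \<open>Suc\<close>.
    The description is meaningful only when each cell is hit exactly once.\<close>
  define sq where "sq S = mat n n (\<lambda>(i, j). Suc (THE t. t < n \<and> S t i = j))"
    for S :: "nat \<Rightarrow> nat \<Rightarrow> nat"
  have sq_iff: "sq S $$ (i, j) = Suc t \<longleftrightarrow> S t i = j"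
    if S: "S \<in> odd_cover_seqs n n" and "i < n" "j < n" "t < n" for S i j t
  proof -
    have ex1: "\<exists>!t. t < n \<and> S t i = j" using S that(2,3) by (auto simp: odd_cover_seqs_diag)
    show ?thesis
      using theI'[OF ex1] ex1 that by (auto simp: sq_def)
  qed
  have sq_le: "sq S $$ (i, j) \<in> {1..n}"
    if S: "S \<in> odd_cover_seqs n n" and "i < n" "j < n" for S i j
  proof -
    have ex1: "\<exists>!t. t < n \<and> S t i = j" using S that(2,3) by (auto simp: odd_cover_seqs_diag)
    show ?thesis using theI'[OF ex1] that by (auto simp: sq_def)
  qed
  have perm: "S t permutes {0..<n}" if "S \<in> odd_cover_seqs n n" "t < n" for S t
    using that by (auto simp: odd_cover_seqs_def PiE_iff)
  have "bij_betw sq (odd_cover_seqs n n) {A. latin_square n A}"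
  proof (rule bij_betw_imageI)
    show "inj_on sq (odd_cover_seqs n n)"
    proof (rule inj_onI)
      fix S S' assume S: "S \<in> odd_cover_seqs n n" and S': "S' \<in> odd_cover_seqs n n"
        and eq: "sq S = sq S'"
      show "S = S'"
      proof (rule PiE_ext)
        show "S \<in> {0..<n} \<rightarrow>\<^sub>E {\<sigma>. \<sigma> permutes {0..<n}}" "S' \<in> {0..<n} \<rightarrow>\<^sub>E {\<sigma>. \<sigma> permutes {0..<n}}"
          using S S' by (auto simp: odd_cover_seqs_def)
        fix t assume t: "t \<in> {0..<n}"
        show "S t = S' t"
        proof
          fix i
          show "S t i = S' t i"
          proof (cases "i < n")
            case True
            have "S t i < n" using perm[OF S, of t] t True permutes_in_image[of "S t" "{0..<n}" i] by simp
            then show ?thesis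
              using sq_iff[OF S True _, of "S t i" t] sq_iff[OF S' True _, of "S t i" t] eq t by simp
          next
            case False
            then show ?thesis
              using perm[OF S, of t] perm[OF S', of t] t by (simp add: permutes_def)
          qed
        qed
      qed
    qed
    show "sq ` odd_cover_seqs n n = {A. latin_square n A}"
    proof (intro equalityI subsetI)
      fix A assume "A \<in> sq ` odd_cover_seqs n n"
      then obtain S where S: "S \<in> odd_cover_seqs n n" and A: "A = sq S" by blast
      have "A \<in> carrier_mat n n" by (simp add: A sq_def)
      moreover have "elements_mat A \<subseteq> {1..n}"
        using sq_le[OF S] by (auto simp: A elements_mat_def sq_def)
      moreover have "\<exists>!j. j < n \<and> A $$ (i, j) = k" if i: "i < n" and k: "k \<in> {1..n}" for i k
      proof -
        obtain t where t: "k = Suc t" "t < n" using k by (cases k) auto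
        have "S t i < n" using perm[OF S t(2)] i permutes_in_image[of "S t" "{0..<n}" i] by simp
        \<comment> \<open>In row \<open>i\<close>, symbol \<open>Suc t\<close> stands in column
          \<open>S t i\<close> and in no other.\<close>
        then show ?thesis using sq_iff[OF S i _ t(2)] unfolding A t(1) by blast
      qed
      moreover have "\<exists>!i. i < n \<and> A $$ (i, j) = k" if j: "j < n" and k: "k \<in> {1..n}" for j k
      proof -
        obtain t where t: "k = Suc t" "t < n" using k by (cases k) auto
        \<comment> \<open>In column \<open>j\<close>, the row of symbol \<open>Suc t\<close> is the
          preimage of \<open>j\<close> under \<open>S t\<close>, which lies below \<open>n\<close>
          because \<open>j\<close> does.\<close>
        have "\<exists>!i. S t i = j" using perm[OF S t(2)] by (auto simp: permutes_def)
        moreover have "i < n" if "S t i = j" for i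
          using perm[OF S t(2)] j that permutes_in_image[of "S t" "{0..<n}" i] by simp
        ultimately show ?thesis using sq_iff[OF S _ j t(2)] unfolding A t(1) by blast
      qed
      ultimately show "A \<in> {A. latin_square n A}" by (simp add: latin_square_def)
    next
      fix A assume "A \<in> {A. latin_square n A}"
      then have carr: "A \<in> carrier_mat n n" and elems: "elements_mat A \<subseteq> {1..n}"
        and row: "\<And>i t. i < n \<Longrightarrow> t < n \<Longrightarrow> \<exists>!j. j < n \<and> A $$ (i, j) = Suc t"
        and col: "\<And>j t. j < n \<Longrightarrow> t < n \<Longrightarrow> \<exists>!i. i < n \<and> A $$ (i, j) = Suc t"
        by (auto simp: latin_square_def)
      \<comment> \<open>The row condition makes the column unique. Rows from \<open>n\<close> on are
        fixed, as \<open>permutes\<close> demands, and the restriction in \<open>t\<close> makes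
        \<open>S\<close> extensional.\<close>
      define S where "S = (\<lambda>t\<in>{0..<n}. \<lambda>i. if i < n then THE j. j < n \<and> A $$ (i, j) = Suc t else i)"
      have S_spec: "S t i < n \<and> A $$ (i, S t i) = Suc t" if "t < n" "i < n" for t i
        using theI'[OF row[OF that(2,1)]] that by (simp add: S_def)
      have S_iff: "S t i = j \<longleftrightarrow> A $$ (i, j) = Suc t" if "t < n" "i < n" "j < n" for t i j
        using S_spec[OF that(1,2)] row[OF that(2,1)] that(3) by blast
      have S_perm: "S t permutes {0..<n}" if t: "t < n" for t
      proof (rule bij_imp_permutes)
        \<comment> \<open>Two rows with the same image would both carry symbol \<open>Suc t\<close>
          in one column, against the column condition; surjectivity then follows by
          finiteness.\<close>
        have "inj_on (S t) {0..<n}"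
        proof (rule inj_onI)
          fix i i' assume "i \<in> {0..<n}" "i' \<in> {0..<n}" and eq: "S t i = S t i'"
          then show "i = i'"
            using S_spec[OF t, of i] S_spec[OF t, of i'] col[of "S t i" t] t by auto
        qed
        moreover have "S t ` {0..<n} \<subseteq> {0..<n}" using S_spec[OF t] by auto
        ultimately show "bij_betw (S t) {0..<n} {0..<n}"
          by (simp add: bij_betw_def endo_inj_surj)
        show "S t i = i" if "i \<notin> {0..<n}" for i using that t by (simp add: S_def)
      qed
      have entry: "\<exists>t<n. A $$ (i, j) = Suc t" if "i < n" "j < n" for i j
      proof -
        have "A $$ (i, j) \<in> {1..n}"
          using elements_matI[OF carr that refl] elems by blast
        then show ?thesis by (cases "A $$ (i, j)") auto
      qed
      have "\<exists>!t. t < n \<and> S t i = j" if ij: "i < n" "j < n" for i j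
      proof -
        obtain t where "t < n" "A $$ (i, j) = Suc t" using entry[OF ij] by blast
        \<comment> \<open>A cell carries only one symbol, so only one permutation can hit
          it.\<close>
        then show ?thesis using S_iff[OF _ ij] by (intro ex1I[of _ t]) (simp, metis Suc_inject)
      qed
      moreover have "S \<in> {0..<n} \<rightarrow>\<^sub>E {\<sigma>. \<sigma> permutes {0..<n}}"
        using S_perm by (auto simp: PiE_iff S_def)
      ultimately have S: "S \<in> odd_cover_seqs n n" by (simp add: odd_cover_seqs_diag)
      have "A = sq S"
      proof (rule eq_matI)
        show "dim_row A = dim_row (sq S)" "dim_col A = dim_col (sq S)"
          using carr by (auto simp: sq_def)
        fix i j assume "i < dim_row (sq S)" "j < dim_col (sq S)"
        then have ij: "i < n" "j < n" by (auto simp: sq_def)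
        obtain t where t: "t < n" "A $$ (i, j) = Suc t" using entry[OF ij] by blast
        then show "A $$ (i, j) = sq S $$ (i, j)"
          using sq_iff[OF S ij t(1)] S_iff[OF t(1) ij] by simp
      qed
      then show "A \<in> sq ` odd_cover_seqs n n" using S by blast
    qed
  qed
  then show ?thesis
    unfolding num_latin_squares_def by (rule bij_betw_same_card)
qed

theorem theorem3:
  fixes n :: nat and p :: "complex poly"
  assumes "n \<ge> 1" and "degree p = n" and "lead_coeff p = 1"
  shows "of_nat (num_latin_squares n) =
    1 / 2 ^ (n ^ 2) * (\<Sum>X\<in>sign_matrices n. poly p (permanent X) * prod_entries X)"
proof -
  have "(\<Sum>X\<in>sign_matrices n. poly p (permanent X) * prod_entries X) =
      (\<Sum>X\<in>sign_matrices n. \<Sum>k\<le>n. coeff p k * (permanent X ^ k * prod_entries X))"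
    by (simp add: poly_altdef assms(2) sum_distrib_right mult.assoc)
  also have "\<dots> = (\<Sum>k\<le>n. coeff p k * (\<Sum>X\<in>sign_matrices n. permanent X ^ k * prod_entries X))"
    by (subst sum.swap) (simp add: sum_distrib_left)
  also have "\<dots> = (\<Sum>k\<le>n. coeff p k * (2 ^ (n ^ 2) * of_nat (card (odd_cover_seqs n k))))"
    by (simp add: sum_sign_matrices_permanent_power)
  \<comment> \<open>Below degree \<open>n\<close> there are no odd covers, so the lower coefficients
    of \<open>p\<close> drop out and only the leading term survives.\<close>
  also have "\<dots> = (\<Sum>k\<in>{n}. coeff p k * (2 ^ (n ^ 2) * of_nat (card (odd_cover_seqs n k))))"
    by (rule sum.mono_neutral_right) (auto simp: odd_cover_seqs_empty)
  also have "\<dots> = 2 ^ (n ^ 2) * of_nat (num_latin_squares n)"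
    using assms(2,3) by (simp add: card_odd_cover_seqs_diag)
  finally show ?thesis by simp
qed

end
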